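(* Let $d$ be an odd positive integer and let $f\in\mathcal{H}(2,d)$ be sharp. Then $$f(x,y)=x^d+y^d+(\text{terms of degree less than } d).$$
   Context: $\mathcal{H}(2,d)$ denotes the set of real polynomials $p(x,y)$ of degree exactly $d$ with nonnegative coefficients such that $p(x,y)=1$ whenever $x+y=1$. For a polynomial $p$, $N(p)$ is the number of distinct monomials with nonzero coefficient in $p$. A polynomial $p\in\mathcal{H}(2,d)$ is called sharp if $N(p)$ is minimal among all elements of $\mathcal{H}(2,d)$. *)

theory Defs
  imports Complex_Main "HOL-Computational_Algebra.Polynomial"
begin

text \<open>A real polynomial in two variables $x, y$ is an element of $\mathbb{R}[x][y]$, that is, of type
  \<^typ>\<open>real poly poly\<close>: the inner variable is $x$, the outer variable is $y$, so the coefficient of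
  $x^i y^j$ in \<open>p\<close> is \<open>coeff (coeff p j) i\<close>.\<close>

definition var_x :: "real poly poly" where
  "var_x = [:[:0, 1:]:]"

definition var_y :: "real poly poly" where
  "var_y = [:0, 1:]"

definition coeff2 :: "real poly poly \<Rightarrow> nat \<Rightarrow> nat \<Rightarrow> real" where
  "coeff2 p i j = coeff (coeff p j) i"

definition eval2 :: "real poly poly \<Rightarrow> real \<Rightarrow> real \<Rightarrow> real" where
  "eval2 p x y = poly (poly p [:y:]) x"

definition monomials :: "real poly poly \<Rightarrow> (nat \<times> nat) set" where
  "monomials p = {(i, j). coeff2 p i j \<noteq> 0}"

text \<open>As for \<^const>\<open>degree\<close>, the zero polynomial is given degree 0.\<close>

definition total_degree :: "real poly poly \<Rightarrow> nat" where
  "total_degree p = Max (insert 0 ((\<lambda>(i, j). i + j) ` monomials p))"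

definition H2 :: "nat \<Rightarrow> real poly poly set" where
  "H2 d = {p. total_degree p = d \<and> (\<forall>i j. coeff2 p i j \<ge> 0) \<and>
              (\<forall>x y. x + y = 1 \<longrightarrow> eval2 p x y = 1)}"

definition num_monomials :: "real poly poly \<Rightarrow> nat" where
  "num_monomials p = card (monomials p)"

definition sharp :: "nat \<Rightarrow> real poly poly \<Rightarrow> bool" where
  "sharp d p \<longleftrightarrow> p \<in> H2 d \<and> (\<forall>q \<in> H2 d. num_monomials p \<le> num_monomials q)"

text \<open>\<^const>\<open>Max\<close> and \<^const>\<open>card\<close> above are only meaningful because \<^const>\<open>monomials\<close> is finite.\<close>

lemma finite_monomials: "finite (monomials p)"
proof -
  have "monomials p \<subseteq> (\<Union>j\<le>degree p. {..degree (coeff p j)} \<times> {j})"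
    by (auto simp: monomials_def coeff2_def intro!: le_degree)
  then show ?thesis
    by (rule finite_subset) auto
qed

lemma eval2_simps:
  "eval2 var_x x y = x" "eval2 var_y x y = y"
  "eval2 (p + q) x y = eval2 p x y + eval2 q x y"
  "eval2 (p * q) x y = eval2 p x y * eval2 q x y"
  by (simp_all add: eval2_def var_x_def var_y_def)

lemma coeff2_monom: "coeff2 (var_x ^ a * var_y ^ b) i j = (if i = a \<and> j = b then 1 else 0)"
proof -
  have "var_x ^ a = [:monom 1 a:]"
    by (induction a) (simp_all add: var_x_def monom_Suc one_pCons monom_0)
  moreover have "var_y ^ b = monom 1 b"
    by (simp add: var_y_def monom_altdef)
  ultimately show ?thesis
    by (simp add: coeff2_def smult_monom)
qed

end

theory Submission imports Defs begin

text \<open>Write \<open>1 - p = (1 - x - y) q\<close>. The homogeneous parts satisfy \<open>q\<^sub>k = (x + y) q\<^sub>k\<^sub>-\<^sub>1 - p\<^sub>k\<close>, and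
  \<open>(x + y) q\<^sub>d\<^sub>-\<^sub>1 = p\<^sub>d\<close>. Substitute \<open>x = - t\<close>, \<open>y = 1\<close> in each part. Multiplication by \<open>x + y\<close> becomes
  multiplication by \<open>1 - t\<close>, which by Descartes' rule creates a sign change, whereas subtracting a
  monomial of \<open>p\<^sub>k\<close> destroys at most two sign changes, and at most one if the monomial is a power of
  \<open>x\<close> or \<open>y\<close>. Nonnegativity of \<open>p\<close> keeps \<open>q\<^sub>k \<noteq> 0\<close> for \<open>k < d\<close>. As \<open>p\<^sub>d\<close> has fewer sign changes
  than terms, this gives \<open>2 N(p) \<ge> d + 1 + N(p\<^sub>d) + 2 N(p\<^sub>0) + E\<close> with \<open>N(p\<^sub>d) \<ge> 2\<close>, where \<open>E\<close> counts
  the pure powers of degree \<open>1, \<dots>, d - 1\<close> in \<open>p\<close>. A Lucas polynomial shows \<open>2 N(p) \<le> d + 3\<close> for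
  sharp \<open>p\<close> and odd \<open>d\<close>. Hence \<open>N(p\<^sub>d) = 2\<close> and \<open>p\<close> has no pure powers of degree below \<open>d\<close>, so
  \<open>p(1, 0) = p(0, 1) = 1\<close> forces \<open>p\<^sub>d = x\<^sup>d + y\<^sup>d\<close>.\<close>

section \<open>Sign alternations\<close>

text \<open>\<open>m\<close> counts the selected entries, one more than the sign changes among them
  when \<open>m > 0\<close>. Only the sign of \<open>\<sigma>\<close> matters, so any nonzero real
  can prescribe the first sign.\<close>

primrec alternates :: "nat \<Rightarrow> (nat \<Rightarrow> real) \<Rightarrow> real \<Rightarrow> nat \<Rightarrow> bool" where
  "alternates 0 r \<sigma> l \<longleftrightarrow> True"
| "alternates (Suc m) r \<sigma> l \<longleftrightarrow> (\<exists>x\<ge>l. \<sigma> * r x > 0 \<and> alternates m r (- \<sigma>) (Suc x))"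

lemma alternates_start_mono:
  "alternates m r \<sigma> l \<Longrightarrow> l' \<le> l \<Longrightarrow> alternates m r \<sigma> l'"
  by (cases m) (auto intro: le_trans)

lemma alternates_Suc_imp:
  "alternates (Suc m) r \<sigma> l \<Longrightarrow> alternates m r \<sigma> l"
  by (induction m arbitrary: \<sigma> l) (simp, metis alternates.simps(2))

lemma alternates_tail:
  "alternates (Suc m) r \<sigma> l \<Longrightarrow> alternates m r (- \<sigma>) l"
  by (auto intro: alternates_start_mono)

lemma alternates_antimono:
  assumes "alternates m r \<sigma> l" "m' \<le> m"
  shows "alternates m' r \<sigma> l"
  using assms(2,1) by (induction rule: inc_induct) (auto dest: alternates_Suc_imp simp del: alternates.simps)

lemma alternates_cong:
  assumes "\<And>i. i \<ge> l \<Longrightarrow> r i = r' i"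
  shows "alternates m r \<sigma> l \<longleftrightarrow> alternates m r' \<sigma> l"
  using assms
proof (induction m arbitrary: \<sigma> l)
  case (Suc m)
  have "alternates m r (- \<sigma>) (Suc x) = alternates m r' (- \<sigma>) (Suc x)" if "x \<ge> l" for x
    using that Suc.prems by (intro Suc.IH) auto
  then show ?case
    using Suc.prems by auto
qed simp

text \<open>If the changed entry is selected, dropping it together with its successor leaves an
  alternation that starts with the same sign.\<close>

lemma alternates_change:
  assumes "\<And>j. j \<noteq> i \<Longrightarrow> r j = r' j"
  shows "alternates m r \<sigma> l \<Longrightarrow> alternates (m - 2) r' \<sigma> l"
proof (induction m arbitrary: \<sigma> l)
  case (Suc m)
  then obtain x where x: "x \<ge> l" "\<sigma> * r x > 0" "alternates m r (- \<sigma>) (Suc x)"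
    by auto
  show ?case
  proof (cases "x = i")
    case True
    then have "alternates m r' (- \<sigma>) (Suc x)"
      using x(3) assms by (subst alternates_cong[of _ r' r]) auto
    then have "alternates (m - 1) r' \<sigma> (Suc x)"
      using alternates_tail[of "m - 1" r' "- \<sigma>"] by (cases m) (auto simp del: alternates.simps(2))
    moreover have "Suc m - 2 = m - 1"
      by simp
    ultimately show ?thesis
      using alternates_start_mono[of _ r' \<sigma> "Suc x" l] x(1) by simp
  next
    case False
    then have "\<sigma> * r' x > 0"
      using x(2) assms by simp
    then have "alternates (Suc (m - 2)) r' \<sigma> l"
      using Suc.IH[OF x(3)] x(1) by auto
    then show ?thesis
      by (rule alternates_antimono) simp
  qed
qed simp

text \<open>Index 0 can only be selected first, so dropping the first entry suffices; the initial
  sign then flips, hence the existential \<open>\<sigma>'\<close>.\<close>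

lemma alternates_change_first:
  assumes "\<And>j. j \<noteq> 0 \<Longrightarrow> r j = r' j" "alternates m r \<sigma> l"
  shows "\<exists>\<sigma>'. alternates (m - 1) r' \<sigma>' l"
proof (cases m)
  case (Suc m')
  then obtain x where x: "x \<ge> l" "alternates m' r (- \<sigma>) (Suc x)"
    using assms(2) by auto
  then have "alternates m' r' (- \<sigma>) (Suc x)"
    using assms(1) by (subst alternates_cong[of _ r' r]) auto
  then have "alternates m' r' (- \<sigma>) l"
    by (rule alternates_start_mono) (use x in simp)
  then show ?thesis
    using Suc by auto
qed simp

text \<open>Everything vanishes beyond \<open>n\<close>, so \<open>n\<close> can only be selected
  last, and giving up the last entry is enough.\<close>

lemma alternates_change_last:
  assumes "\<And>j. j \<noteq> n \<Longrightarrow> r j = r' j" "\<And>j. j > n \<Longrightarrow> r j = 0"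
  shows "alternates m r \<sigma> l \<Longrightarrow> alternates (m - 1) r' \<sigma> l"
proof (induction m arbitrary: \<sigma> l)
  case (Suc m)
  then obtain x where x: "x \<ge> l" "\<sigma> * r x > 0" "alternates m r (- \<sigma>) (Suc x)"
    by auto
  show ?case
  proof (cases m)
    case (Suc m')
    then have "x \<noteq> n"
      using x(3) assms(2) by (auto simp: less_eq_Suc_le)
    then have "\<sigma> * r' x > 0"
      using x(2) assms(1) by simp
    then have "alternates (Suc (m - 1)) r' \<sigma> l"
      using Suc.IH[OF x(3)] x(1) by auto
    then show ?thesis
      using Suc by simp
  qed simp
qed simp

text \<open>The entries are changed one at a time. Since \<open>D\<close> lies in
  \<open>{..n}\<close>, the intermediate sequences still vanish beyond \<open>n\<close>, so index
  \<open>n\<close> keeps its low price.\<close>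

lemma alternates_change_set:
  assumes "finite D" "\<And>j. j \<notin> D \<Longrightarrow> r j = r' j"
    and "\<And>j. j > n \<Longrightarrow> r j = 0" "D \<subseteq> {..n}"
    and "alternates (m + (\<Sum>i\<in>D. if i = 0 \<or> i = n then 1 else 2)) r \<sigma> 0"
  shows "\<exists>\<sigma>'. alternates m r' \<sigma>' 0"
  using assms
proof (induction D arbitrary: r \<sigma> rule: finite_induct)
  case empty
  then have "r = r'"
    by auto
  then show ?case
    using empty by auto
next
  case (insert i D)
  define r1 where "r1 = r(i := r' i)"
  define w where "w = (\<Sum>i\<in>D. if i = 0 \<or> i = n then 1 else 2 :: nat)"
  have alt: "alternates (m + (w + (if i = 0 \<or> i = n then 1 else 2))) r \<sigma> 0"
    using insert.prems(4) insert.hyps by (simp add: w_def add_ac)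
  have off: "r j = r1 j" if "j \<noteq> i" for j
    using that by (simp add: r1_def)
  have "\<exists>\<sigma>'. alternates (m + w) r1 \<sigma>' 0"
  proof -
    consider "i = 0" | "i = n" "i \<noteq> 0" | "i \<noteq> 0" "i \<noteq> n"
      by blast
    then show ?thesis
    proof cases
      case 1
      then show ?thesis
        using alternates_change_first[of r r1 "m + w + 1" \<sigma> 0] alt off by (simp del: alternates.simps)
    next
      case 2
      then show ?thesis
        using alternates_change_last[of n r r1 "m + w + 1" \<sigma> 0] alt off insert.prems(2)
        by (auto simp del: alternates.simps)
    next
      case 3
      then show ?thesis
        using alternates_change[of i r r1 "m + w + 2" \<sigma> 0] alt off
        by (auto simp del: alternates.simps)
    qed
  qed
  then obtain \<sigma>' where "alternates (m + w) r1 \<sigma>' 0"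
    by blast
  then show ?case
    using insert.prems(1-3)
    by (intro insert.IH[of r1 \<sigma>']) (auto simp: w_def r1_def fun_upd_def)
qed

lemma alternates_le_card:
  assumes "finite {i. r i \<noteq> 0}"
  shows "alternates m r \<sigma> l \<Longrightarrow> m \<le> card {i. i \<ge> l \<and> r i \<noteq> 0}"
proof (induction m arbitrary: \<sigma> l)
  case (Suc m)
  then obtain x where x: "x \<ge> l" "\<sigma> * r x > 0" "alternates m r (- \<sigma>) (Suc x)"
    by auto
  have fin: "finite {i. i \<ge> k \<and> r i \<noteq> 0}" for k
    using assms by (rule rev_finite_subset) auto
  have "Suc m \<le> card (insert x {i. i \<ge> Suc x \<and> r i \<noteq> 0})"
    using Suc.IH[OF x(3)] fin by simp
  also have "\<dots> \<le> card {i. i \<ge> l \<and> r i \<noteq> 0}"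
    using x fin by (intro card_mono) auto
  finally show ?case .
qed simp

text \<open>The step of Descartes' rule of signs: multiplication by \<open>1 - t\<close> creates a sign alternation.\<close>

lemma coeff_one_minus_mult:
  fixes p :: "real poly"
  shows "coeff ([:1, -1:] * p) i = coeff p i - (if i = 0 then 0 else coeff p (i - 1))"
  by (cases i) simp_all

text \<open>After each selected coefficient comes a place where its sign is lost, and there the
  difference of neighbours has the opposite sign. The last selected one has such a place too,
  because the coefficients eventually vanish: this is the extra alternation.\<close>

lemma alternates_mult_tail:
  fixes p :: "real poly"
  assumes "\<sigma> * coeff p x > 0" "alternates m (coeff p) (- \<sigma>) (Suc x)"
  shows "alternates (Suc m) (coeff ([:1, -1:] * p)) (- \<sigma>) (Suc x)"
  using assms
proof (induction m arbitrary: \<sigma> x)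
  have drop: "\<exists>i>x. i \<le> y \<and> - \<sigma> * coeff ([:1, -1:] * p) i > 0"
    if "x < y" "\<sigma> * coeff p x > 0" "\<sigma> * coeff p y \<le> 0" for x y \<sigma>
  proof -
    \<comment> \<open>By minimality the coefficient at \<open>i - 1\<close> still has sign
      \<open>\<sigma>\<close>, while the one at \<open>i\<close> does not.\<close>
    define i where "i = (LEAST i. x < i \<and> \<sigma> * coeff p i \<le> 0)"
    have i: "x < i" "\<sigma> * coeff p i \<le> 0"
      using LeastI[of "\<lambda>i. x < i \<and> \<sigma> * coeff p i \<le> 0" y] that by (auto simp: i_def)
    have "i \<le> y"
      unfolding i_def by (rule Least_le) (use that in auto)
    have "\<not> (x < i - 1 \<and> \<sigma> * coeff p (i - 1) \<le> 0)"
      using i(1) unfolding i_def by (intro not_less_Least) simp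
    then have "\<sigma> * coeff p (i - 1) > 0"
      using i(1) that(2) by (cases "x = i - 1") auto
    then have "- \<sigma> * coeff ([:1, -1:] * p) i > 0"
      using i by (simp only: coeff_one_minus_mult) (simp add: algebra_simps)
    then show ?thesis
      using i(1) \<open>i \<le> y\<close> by blast
  qed
  {
    case 0
    have "\<exists>i>x. i \<le> Suc (x + degree p) \<and> - \<sigma> * coeff ([:1, -1:] * p) i > 0"
      by (rule drop) (use 0 in \<open>auto simp: coeff_eq_0\<close>)
    then show ?case
      by (auto simp: Suc_le_eq simp del: mult_pCons_left)
  next
    case (Suc m)
    then obtain y where y: "Suc x \<le> y" "- \<sigma> * coeff p y > 0" "alternates m (coeff p) \<sigma> (Suc y)"
      by auto
    have "alternates (Suc m) (coeff ([:1, -1:] * p)) \<sigma> (Suc y)"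
      using Suc.IH[of "- \<sigma>" y] y by (simp del: alternates.simps mult_pCons_left)
    moreover obtain i where i: "x < i" "i \<le> y" "- \<sigma> * coeff ([:1, -1:] * p) i > 0"
      using drop[of x y \<sigma>] Suc.prems y by auto
    ultimately have "alternates (Suc m) (coeff ([:1, -1:] * p)) \<sigma> (Suc i)"
      by (meson alternates_start_mono Suc_le_mono)
    then show ?case
      using i by (subst alternates.simps(2)) (auto simp: Suc_le_eq simp del: mult_pCons_left)
  }
qed

lemma alternates_mult:
  fixes p :: "real poly"
  assumes "alternates (Suc m) (coeff p) \<sigma> 0"
  shows "alternates (Suc (Suc m)) (coeff ([:1, -1:] * p)) \<sigma> 0"
proof -
  obtain x where x: "\<sigma> * coeff p x > 0" "alternates m (coeff p) (- \<sigma>) (Suc x)"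
    using assms by auto
  \<comment> \<open>The predecessor of the first coefficient of sign \<open>\<sigma>\<close> lacks
    that sign, so the difference at \<open>i\<close> keeps it and can be put in front of the
    tail.\<close>
  define i where "i = (LEAST i. \<sigma> * coeff p i > 0)"
  have i: "\<sigma> * coeff p i > 0"
    unfolding i_def by (rule LeastI[of "\<lambda>i. \<sigma> * coeff p i > 0"]) (rule x(1))
  have "i \<le> x"
    unfolding i_def by (rule Least_le) (rule x(1))
  have "\<sigma> * coeff p (i - 1) \<le> 0" if "i > 0"
    using not_less_Least[of "i - 1" "\<lambda>i. \<sigma> * coeff p i > 0"] that
    by (fold i_def) simp
  then have "\<sigma> * coeff ([:1, -1:] * p) i > 0"
    using i by (simp only: coeff_one_minus_mult) (auto simp: algebra_simps)
  moreover have "alternates (Suc m) (coeff ([:1, -1:] * p)) (- \<sigma>) (Suc i)"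
    using alternates_mult_tail[OF x] \<open>i \<le> x\<close> by (meson alternates_start_mono Suc_le_mono)
  ultimately show ?thesis
    by (subst alternates.simps(2)) auto
qed

lemma alternates_nonzero:
  fixes p :: "real poly"
  assumes "p \<noteq> 0"
  shows "\<exists>\<sigma>. alternates (Suc 0) (coeff p) \<sigma> 0"
proof -
  have "lead_coeff p * lead_coeff p > 0"
    using assms by (simp flip: power2_eq_square)
  then have "alternates (Suc 0) (coeff p) (lead_coeff p) 0"
    by auto
  then show ?thesis
    by blast
qed

text \<open>Extends the gain to \<open>m = 0\<close>, where nonvanishing of \<open>p\<close>
  supplies a first alternation.\<close>

lemma alternates_mult_nonzero:
  fixes p :: "real poly"
  assumes "p \<noteq> 0" "alternates m (coeff p) \<sigma> 0"
  shows "\<exists>\<sigma>. alternates (Suc m) (coeff ([:1, -1:] * p)) \<sigma> 0"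
proof (cases m)
  case 0
  obtain \<tau> where "alternates (Suc 0) (coeff p) \<tau> 0"
    using alternates_nonzero[OF assms(1)] by blast
  from alternates_mult[OF this] show ?thesis
    using 0 by (auto dest: alternates_Suc_imp simp del: alternates.simps mult_pCons_left)
next
  case (Suc m')
  then show ?thesis
    using alternates_mult[of m' p \<sigma>] assms by blast
qed

section \<open>Homogeneous rows\<close>

text \<open>The coefficients of \<open>p (- t, 1)\<close> for the homogeneous part \<open>p\<close> of degree \<open>k\<close>. The substitution
  turns \<open>x + y\<close> into \<open>1 - t\<close>.\<close>

definition row :: "(nat \<Rightarrow> nat \<Rightarrow> real) \<Rightarrow> nat \<Rightarrow> real poly" where
  "row c k = (\<Sum>i\<le>k. monom ((-1) ^ i * c i (k - i)) i)"

text \<open>The homogeneous parts of \<open>(1 - p) / (1 - x - y)\<close>, a priori a power series, under the same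
  substitution.\<close>

primrec quot :: "(nat \<Rightarrow> nat \<Rightarrow> real) \<Rightarrow> nat \<Rightarrow> real poly" where
  "quot c 0 = 1 - row c 0"
| "quot c (Suc k) = [:1, -1:] * quot c k - row c (Suc k)"

definition row_supp :: "(nat \<Rightarrow> nat \<Rightarrow> real) \<Rightarrow> nat \<Rightarrow> nat set" where
  "row_supp c k = {i. i \<le> k \<and> c i (k - i) \<noteq> 0}"

text \<open>Bounds the alternations destroyed by subtracting row \<open>k\<close>: pure powers sit
  at its ends and cost one, mixed monomials two.\<close>

definition row_cost :: "(nat \<Rightarrow> nat \<Rightarrow> real) \<Rightarrow> nat \<Rightarrow> nat" where
  "row_cost c k = (\<Sum>i\<in>row_supp c k. if i = 0 \<or> i = k then 1 else 2)"

lemma coeff_row: "coeff (row c k) i = (if i \<le> k then (-1) ^ i * c i (k - i) else 0)"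
  by (simp add: row_def coeff_sum)

lemma finite_row_supp [simp]: "finite (row_supp c k)"
  by (simp add: row_supp_def)

lemma coeff_row_nonzero: "{i. coeff (row c k) i \<noteq> 0} = row_supp c k"
  by (auto simp: row_supp_def coeff_row)

lemma degree_quot: "degree (quot c k) \<le> k"
proof (induction k)
  case (Suc k)
  have "degree ([:1, -1:] * quot c k) \<le> degree [:1, -1::real:] + degree (quot c k)"
    by (rule degree_mult_le)
  also have "\<dots> \<le> Suc k"
    using Suc by simp
  finally have "degree ([:1, -1:] * quot c k) \<le> Suc k" .
  moreover have "degree (row c (Suc k)) \<le> Suc k"
    by (rule degree_le) (simp add: coeff_row)
  ultimately show ?case
    unfolding quot.simps by (rule degree_diff_le)
next
  case 0
  have "degree (row c 0) \<le> 0"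
    by (rule degree_le) (simp add: coeff_row)
  then show ?case
    unfolding quot.simps by (intro degree_diff_le) simp_all
qed

text \<open>Divided by \<open>(1 - t) ^ k\<close>, the recurrence for \<open>quot\<close>
  telescopes.\<close>

lemma poly_quot:
  assumes "t \<noteq> 1"
  shows "poly (quot c k) t / (1 - t) ^ k = 1 - (\<Sum>j\<le>k. poly (row c j) t / (1 - t) ^ j)"
proof (induction k)
  case (Suc k)
  have "poly (quot c (Suc k)) t / (1 - t) ^ Suc k =
      (1 - t) * poly (quot c k) t / (1 - t) ^ Suc k - poly (row c (Suc k)) t / (1 - t) ^ Suc k"
    by (simp add: diff_divide_distrib[symmetric] left_diff_distrib)
  also have "(1 - t) * poly (quot c k) t / (1 - t) ^ Suc k = poly (quot c k) t / (1 - t) ^ k"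
    using assms by simp
  finally show ?case
    using Suc by simp
qed simp

text \<open>The nonzero \<open>quot c 0\<close> starts with one alternation; each further degree
  gains one from the factor \<open>1 - t\<close> and loses at most \<open>row_cost\<close>.\<close>

lemma alternates_quot:
  assumes "\<And>j. j \<le> k \<Longrightarrow> quot c j \<noteq> 0" and "m + (\<Sum>j=1..k. row_cost c j) \<le> k + 1"
  shows "\<exists>\<sigma>. alternates m (coeff (quot c k)) \<sigma> 0"
  using assms
proof (induction k arbitrary: m)
  case 0
  obtain \<sigma> where "alternates (Suc 0) (coeff (quot c 0)) \<sigma> 0"
    using alternates_nonzero 0(1)[of 0] by blast
  then have "alternates m (coeff (quot c 0)) \<sigma> 0"
    by (rule alternates_antimono) (use 0(2) in simp)
  then show ?case
    by blast
next
  case (Suc k)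
  define m' where "m' = m + row_cost c (Suc k)"
  have m': "m' + (\<Sum>j=1..k. row_cost c j) \<le> k + 2"
    using Suc.prems(2) by (simp add: m'_def)
  have "\<exists>\<sigma>. alternates (m' - 1) (coeff (quot c k)) \<sigma> 0"
  proof (cases "m' = 0")
    case False
    then show ?thesis
      using m' Suc.prems(1) by (intro Suc.IH) auto
  qed simp
  then obtain \<sigma> where "alternates (m' - 1) (coeff (quot c k)) \<sigma> 0"
    by blast
  then have "\<exists>\<sigma>. alternates (Suc (m' - 1)) (coeff ([:1, -1:] * quot c k)) \<sigma> 0"
    using Suc.prems(1) by (intro alternates_mult_nonzero) auto
  then obtain \<sigma>' where "alternates (Suc (m' - 1)) (coeff ([:1, -1:] * quot c k)) \<sigma>' 0"
    by blast
  then have "alternates m' (coeff ([:1, -1:] * quot c k)) \<sigma>' 0"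
    by (rule alternates_antimono) simp
  then have alt: "alternates (m + (\<Sum>i\<in>row_supp c (Suc k). if i = 0 \<or> i = Suc k then 1 else 2))
      (coeff ([:1, -1:] * quot c k)) \<sigma>' 0"
    by (simp only: m'_def row_cost_def)
  show ?case
  proof (rule alternates_change_set[OF _ _ _ _ alt])
    show "coeff ([:1, -1:] * quot c k) j = coeff (quot c (Suc k)) j"
      if "j \<notin> row_supp c (Suc k)" for j
    proof -
      have "coeff (row c (Suc k)) j = 0"
        using that by (auto simp flip: coeff_row_nonzero)
      then show ?thesis
        by simp
    qed
    show "coeff ([:1, -1:] * quot c k) j = 0" if "j > Suc k" for j
      using that degree_quot[of c k]
      by (simp only: coeff_one_minus_mult) (simp add: coeff_eq_0)
  qed (auto simp: row_supp_def)
qed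

text \<open>The point \<open>t = -1\<close> stands for \<open>x = y = 1\<close>: rows have
  nonnegative values and \<open>1 - t\<close> is 2. The recurrence is run downwards from
  \<open>quot c d = 0\<close>, the nonempty top row giving strictness.\<close>

lemma quot_at_minus_one_pos:
  assumes nonneg: "\<And>i j. c i j \<ge> 0" and "row_supp c d \<noteq> {}" and "quot c d = 0" and "k < d"
  shows "poly (quot c k) (-1) > 0"
proof -
  have row_eq: "poly (row c j) (-1) = (\<Sum>i\<le>j. c i (j - i))" for j
    by (simp add: row_def poly_sum poly_monom mult_ac flip: power_mult_distrib)
  have step: "2 * poly (quot c j) (-1) = poly (quot c (Suc j)) (-1) + poly (row c (Suc j)) (-1)" for j
    by simp
  obtain d' where d': "d = Suc d'"
    using \<open>k < d\<close> by (cases d) auto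
  have "k \<le> d'"
    using \<open>k < d\<close> d' by simp
  then show ?thesis
  proof (induction rule: inc_induct)
    case base
    obtain i where "i \<le> d" "c i (d - i) \<noteq> 0"
      using assms(2) by (auto simp: row_supp_def)
    then have "(\<Sum>i\<le>d. c i (d - i)) > 0"
      using nonneg[of i "d - i"] by (intro sum_pos2[of _ i]) (auto simp: nonneg less_le)
    then show ?case
      using step[of d'] row_eq[of d] assms(3) by (simp only: flip: d') simp
  next
    case (step n)
    have "(\<Sum>i\<le>Suc n. c i (Suc n - i)) \<ge> 0"
      by (intro sum_nonneg) (simp add: nonneg)
    then show ?case
      using step.IH \<open>\<And>j. 2 * poly (quot c j) (-1) = _ j\<close>[of n] row_eq[of "Suc n"] by linarith
  qed
qed

text \<open>As \<open>quot c d = 0\<close>, the top row is \<open>1 - t\<close> times the preceding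
  quotient. This last multiplication gains one more alternation, and alternations never outnumber
  nonzero coefficients.\<close>

lemma card_row_supp_top:
  assumes nonneg: "\<And>i j. c i j \<ge> 0" and "row_supp c d \<noteq> {}" and "quot c d = 0" and "d > 0"
  shows "card (row_supp c d) \<ge> 2" "card (row_supp c d) + (\<Sum>j=1..<d. row_cost c j) \<ge> d + 1"
proof -
  have nz: "quot c k \<noteq> 0" if "k < d" for k
    using quot_at_minus_one_pos[OF nonneg assms(2,3) that] by auto
  obtain d' where d': "d = Suc d'"
    using \<open>d > 0\<close> by (cases d) auto
  have row: "[:1, -1:] * quot c d' = row c d"
    using \<open>quot c d = 0\<close> by (simp add: d')
  have le: "Suc m \<le> card (row_supp c d)" if "\<exists>\<sigma>. alternates m (coeff (quot c d')) \<sigma> 0" for m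
  proof -
    from that obtain \<sigma> where "alternates m (coeff (quot c d')) \<sigma> 0"
      by blast
    from alternates_mult_nonzero[OF _ this] nz[of d'] obtain \<sigma>'
      where "alternates (Suc m) (coeff (row c d)) \<sigma>' 0"
      unfolding row by (auto simp only: d' lessI simp_thms)
    then have "Suc m \<le> card {i. i \<ge> 0 \<and> coeff (row c d) i \<noteq> 0}"
      by (intro alternates_le_card) (simp_all add: coeff_row_nonzero)
    then show ?thesis
      by (simp add: coeff_row_nonzero)
  qed
  show "card (row_supp c d) \<ge> 2"
    using le[of "Suc 0"] alternates_nonzero nz[of d'] by (auto simp: d' simp del: alternates.simps)
  define s where "s = (\<Sum>j=1..<d. row_cost c j)"
  have s: "s = (\<Sum>j=1..d'. row_cost c j)"
    by (simp add: s_def d' atLeastLessThanSuc_atLeastAtMost)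
  show "card (row_supp c d) + (\<Sum>j=1..<d. row_cost c j) \<ge> d + 1"
  \<comment> \<open>\<open>d - s\<close> is the largest count that \<open>alternates_quot\<close>
    yields in degree \<open>d - 1\<close>; truncated subtraction makes \<open>s > d\<close> a
    separate, immediate case.\<close>
  proof (cases "s \<le> d")
    case True
    then have "\<exists>\<sigma>. alternates (d - s) (coeff (quot c d')) \<sigma> 0"
      using nz s d' by (intro alternates_quot) auto
    from le[OF this] show ?thesis
      using True unfolding s_def[symmetric] by simp
  next
    case False
    then show ?thesis
      unfolding s_def[symmetric] by simp
  qed
qed

text \<open>A pure power costs one instead of two; this strictness later excludes pure powers of
  degree strictly between 0 and \<open>d\<close>.\<close>

lemma row_cost_less:
  assumes "c 0 k \<noteq> 0 \<or> c k 0 \<noteq> 0"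
  shows "row_cost c k < 2 * card (row_supp c k)"
proof -
  have "row_cost c k < (\<Sum>i\<in>row_supp c k. 2)"
    unfolding row_cost_def
  proof (rule sum_strict_mono_ex1)
    show "\<exists>i\<in>row_supp c k. (if i = 0 \<or> i = k then 1 else 2) < (2::nat)"
      using assms
    proof
      assume "c 0 k \<noteq> 0"
      then show ?thesis
        by (intro bexI[of _ 0]) (auto simp: row_supp_def)
    next
      assume "c k 0 \<noteq> 0"
      then show ?thesis
        by (intro bexI[of _ k]) (auto simp: row_supp_def)
    qed
  qed auto
  then show ?thesis
    by simp
qed

lemma row_cost_le: "row_cost c k \<le> 2 * card (row_supp c k)"
proof -
  have "row_cost c k \<le> (\<Sum>i\<in>row_supp c k. 2)"
    unfolding row_cost_def by (intro sum_mono) auto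
  then show ?thesis
    by simp
qed

section \<open>Polynomials in two variables\<close>

lemma eval2_eq_sum:
  assumes "finite S" "monomials p \<subseteq> S"
  shows "eval2 p x y = (\<Sum>(i, j)\<in>S. coeff2 p i j * x ^ i * y ^ j)"
proof -
  \<comment> \<open>A common bound for the inner degrees turns the double sum into one over a
    rectangle.\<close>
  define D where "D = Max (insert 0 ((\<lambda>j. degree (coeff p j)) ` {..degree p}))"
  have D: "degree (coeff p j) \<le> D" if "j \<le> degree p" for j
    unfolding D_def using that by (intro Max_ge) auto
  have "eval2 p x y = (\<Sum>j\<le>degree p. poly (coeff p j) x * y ^ j)"
    unfolding eval2_def by (subst poly_altdef) (simp add: poly_sum)
  also have "\<dots> = (\<Sum>j\<le>degree p. \<Sum>i\<le>D. coeff2 p i j * x ^ i * y ^ j)"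
  proof (intro sum.cong refl)
    fix j assume "j \<in> {..degree p}"
    then have "poly (coeff p j) x = (\<Sum>i\<le>D. coeff2 p i j * x ^ i)"
      unfolding poly_altdef coeff2_def
      using D by (intro sum.mono_neutral_left) (auto simp: coeff_eq_0)
    then show "poly (coeff p j) x * y ^ j = (\<Sum>i\<le>D. coeff2 p i j * x ^ i * y ^ j)"
      by (simp add: sum_distrib_right)
  qed
  also have "\<dots> = (\<Sum>i\<le>D. \<Sum>j\<le>degree p. coeff2 p i j * x ^ i * y ^ j)"
    by (rule sum.swap)
  also have "\<dots> = (\<Sum>(i, j)\<in>{..D} \<times> {..degree p}. coeff2 p i j * x ^ i * y ^ j)"
    by (simp add: sum.cartesian_product)
  also have "\<dots> = (\<Sum>(i, j)\<in>monomials p. coeff2 p i j * x ^ i * y ^ j)"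
  proof (rule sum.mono_neutral_right)
    show "monomials p \<subseteq> {..D} \<times> {..degree p}"
    proof (rule subrelI)
      fix i j assume "(i, j) \<in> monomials p"
      then have nz: "coeff (coeff p j) i \<noteq> 0"
        by (simp add: monomials_def coeff2_def)
      then have j: "j \<le> degree p"
        by (intro le_degree) auto
      have "i \<le> degree (coeff p j)"
        using nz by (rule le_degree)
      with D[OF j] j show "(i, j) \<in> {..D} \<times> {..degree p}"
        by simp
    qed
  qed (auto simp: monomials_def)
  also have "\<dots> = (\<Sum>(i, j)\<in>S. coeff2 p i j * x ^ i * y ^ j)"
    using assms by (intro sum.mono_neutral_left) (auto simp: monomials_def)
  finally show ?thesis .
qed

lemma monomials_degree_le:
  assumes "coeff2 p i j \<noteq> 0"
  shows "i + j \<le> total_degree p"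
  unfolding total_degree_def
proof (rule Max_ge)
  show "i + j \<in> insert 0 ((\<lambda>(i, j). i + j) ` monomials p)"
    using assms by (force simp: monomials_def)
qed (simp add: finite_monomials)

lemma total_degree_less:
  assumes "d > 0" "\<And>i j. coeff2 p i j \<noteq> 0 \<Longrightarrow> i + j < d"
  shows "total_degree p < d"
  unfolding total_degree_def
proof (subst Max_less_iff)
  show "\<forall>a\<in>insert 0 ((\<lambda>(i, j). i + j) ` monomials p). a < d"
    using assms by (auto simp: monomials_def)
qed (simp_all add: finite_monomials)

lemma total_degree_attained:
  assumes "total_degree p > 0"
  shows "\<exists>i j. coeff2 p i j \<noteq> 0 \<and> i + j = total_degree p"
proof -
  have "total_degree p \<in> insert 0 ((\<lambda>(i, j). i + j) ` monomials p)"
    unfolding total_degree_def by (rule Max_in) (auto simp: finite_monomials)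
  then have "total_degree p \<in> (\<lambda>(i, j). i + j) ` monomials p"
    using assms by simp
  then obtain i j where "(i, j) \<in> monomials p" "total_degree p = i + j"
    by auto
  then show ?thesis
    by (intro exI[of _ i] exI[of _ j]) (simp add: monomials_def)
qed

lemma eval2_rows:
  assumes "total_degree p = d"
  shows "eval2 p x y = (\<Sum>k\<le>d. \<Sum>i\<le>k. coeff2 p i (k - i) * x ^ i * y ^ (k - i))"
proof -
  have "monomials p \<subseteq> {(i, j). i + j \<le> d}"
    using monomials_degree_le assms by (auto simp: monomials_def)
  moreover have "finite {(i, j). i + j \<le> d}"
    by (rule finite_subset[of _ "{..d} \<times> {..d}"]) auto
  ultimately have "eval2 p x y = (\<Sum>(i, j)\<in>{(i, j). i + j \<le> d}. coeff2 p i j * x ^ i * y ^ j)"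
    by (intro eval2_eq_sum)
  then show ?thesis
    by (simp add: sum.triangle_reindex_eq)
qed

lemma num_monomials_rows:
  assumes "total_degree p = d"
  shows "num_monomials p = (\<Sum>k\<le>d. card (row_supp (coeff2 p) k))"
proof -
  have sub: "monomials p \<subseteq> {(i, j). i + j \<le> d}"
    using monomials_degree_le assms by (auto simp: monomials_def)
  have fin: "finite {(i, j). i + j \<le> d}"
    by (rule finite_subset[of _ "{..d} \<times> {..d}"]) auto
  have "num_monomials p = (\<Sum>(i, j)\<in>monomials p. if coeff2 p i j \<noteq> 0 then 1 else 0)"
    unfolding num_monomials_def by (subst card_eq_sum, rule sum.cong) (auto simp: monomials_def)
  also have "\<dots> = (\<Sum>(i, j)\<in>{(i, j). i + j \<le> d}. if coeff2 p i j \<noteq> 0 then 1 else 0)"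
    using sub fin by (intro sum.mono_neutral_left) (auto simp: monomials_def)
  also have "\<dots> = (\<Sum>k\<le>d. \<Sum>i\<le>k. if coeff2 p i (k - i) \<noteq> 0 then 1 else 0)"
    by (rule sum.triangle_reindex_eq)
  also have "\<dots> = (\<Sum>k\<le>d. card (row_supp (coeff2 p) k))"
    by (simp add: row_supp_def flip: sum.inter_filter)
  finally show ?thesis .
qed

text \<open>The point \<open>(- t / (1 - t), 1 / (1 - t))\<close> lies on the line
  \<open>x + y = 1\<close>, and there the homogeneous part of degree \<open>k\<close> equals the row
  divided by \<open>(1 - t) ^ k\<close>. By \<open>poly_quot\<close>, the quotient then vanishes at
  every \<open>t \<noteq> 1\<close>.\<close>

lemma quot_H2_eq_0:
  assumes "p \<in> H2 d"
  shows "quot (coeff2 p) d = 0"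
proof (rule ccontr)
  assume nz: "quot (coeff2 p) d \<noteq> 0"
  have "poly (quot (coeff2 p) d) t = 0" if "t \<noteq> 1" for t
  proof -
    have "poly (row (coeff2 p) k) t / (1 - t) ^ k =
        (\<Sum>i\<le>k. coeff2 p i (k - i) * (- t / (1 - t)) ^ i * (1 / (1 - t)) ^ (k - i))" for k
    proof -
      have "(-1) ^ i * coeff2 p i (k - i) * t ^ i / (1 - t) ^ k =
          coeff2 p i (k - i) * (- t / (1 - t)) ^ i * (1 / (1 - t)) ^ (k - i)" if "i \<le> k" for i
      proof -
        have "(1 - t) ^ k = (1 - t) ^ i * (1 - t) ^ (k - i)"
          using that by (simp flip: power_add)
        moreover have "(- t / (1 - t)) ^ i = (-1) ^ i * t ^ i / (1 - t) ^ i"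
          by (simp only: power_divide power_minus[of t])
        ultimately show ?thesis
          by (simp add: power_one_over divide_simps)
      qed
      then show ?thesis
        by (simp add: row_def poly_sum poly_monom sum_divide_distrib mult_ac)
    qed
    then have "poly (quot (coeff2 p) d) t / (1 - t) ^ d = 1 - eval2 p (- t / (1 - t)) (1 / (1 - t))"
      using poly_quot[OF that, of "coeff2 p" d] assms by (simp add: eval2_rows[of p d] H2_def)
    also have "- t / (1 - t) + 1 / (1 - t) = 1"
      using that by (simp add: field_simps)
    then have "eval2 p (- t / (1 - t)) (1 / (1 - t)) = 1"
      using assms by (simp add: H2_def)
    finally show ?thesis
      using that by simp
  qed
  then have "UNIV - {1} \<subseteq> {t. poly (quot (coeff2 p) d) t = 0}"
    by auto
  then have "finite (UNIV - {1 :: real})"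
    using poly_roots_finite[OF nz] by (rule finite_subset)
  then show False
    by (simp add: infinite_UNIV_char_0)
qed

section \<open>A competitor with few monomials\<close>

text \<open>The bivariate Lucas polynomials: power sums of the two roots of
  \<open>t^2 = x t + y\<close>, hence the initial values 2 and \<open>x\<close>.\<close>

fun lucas2 :: "nat \<Rightarrow> real poly poly" where
  "lucas2 0 = 2"
| "lucas2 (Suc 0) = var_x"
| "lucas2 (Suc (Suc n)) = var_x * lucas2 (Suc n) + var_y * lucas2 n"

lemma coeff2_add: "coeff2 (p + q) i j = coeff2 p i j + coeff2 q i j"
  by (simp add: coeff2_def)

lemma coeff2_diff: "coeff2 (p - q) i j = coeff2 p i j - coeff2 q i j"
  by (simp add: coeff2_def)

lemma coeff2_var_x_mult: "coeff2 (var_x * p) i j = (if i = 0 then 0 else coeff2 p (i - 1) j)"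
  by (cases i) (simp_all add: coeff2_def var_x_def)

lemma coeff2_var_y_mult: "coeff2 (var_y * p) i j = (if j = 0 then 0 else coeff2 p i (j - 1))"
  by (cases j) (simp_all add: coeff2_def var_y_def)

lemma coeff2_2: "coeff2 2 i j = (if i = 0 \<and> j = 0 then 2 else 0)"
proof -
  have two: "(2 :: real poly poly) = [:[:2:]:]"
    by (simp add: numeral_poly)
  show ?thesis
    unfolding coeff2_def two by (auto simp: coeff_pCons simp del: numeral_poly split: nat.split)
qed

lemma coeff2_var_x: "coeff2 var_x i j = (if i = 1 \<and> j = 0 then 1 else 0)"
  using coeff2_monom[of 1 0 i j] by simp

lemma coeff2_lucas2_nonneg: "coeff2 (lucas2 n) i j \<ge> 0"
  by (induction n arbitrary: i j rule: lucas2.induct)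
    (auto simp: coeff2_2 coeff2_var_x coeff2_add coeff2_var_x_mult coeff2_var_y_mult)

text \<open>The recurrence is homogeneous when \<open>y\<close> has weight 2. This leaves at most
  \<open>n div 2 + 1\<close> monomials.\<close>

lemma coeff2_lucas2_weight: "coeff2 (lucas2 n) i j \<noteq> 0 \<Longrightarrow> i + 2 * j = n"
proof (induction n arbitrary: i j rule: lucas2.induct)
  case (3 n)
  from 3(3) have "i \<noteq> 0 \<and> coeff2 (lucas2 (Suc n)) (i - 1) j \<noteq> 0 \<or> j \<noteq> 0 \<and> coeff2 (lucas2 n) i (j - 1) \<noteq> 0"
    by (auto simp: coeff2_add coeff2_var_x_mult coeff2_var_y_mult split: if_splits)
  then show ?case
    using 3(1)[of "i - 1" j] 3(2)[of i "j - 1"] by auto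
qed (auto simp: coeff2_2 coeff2_var_x split: if_splits)

lemma coeff2_lucas2_lead: "n > 0 \<Longrightarrow> coeff2 (lucas2 n) n 0 = 1"
  by (induction n rule: lucas2.induct)
    (auto simp: coeff2_2 coeff2_var_x coeff2_add coeff2_var_x_mult coeff2_var_y_mult)

text \<open>For \<open>x + y = 1\<close> the roots of \<open>t\<^sup>2 = x t + y\<close> are \<open>1\<close> and \<open>- y\<close>.\<close>

lemma eval2_lucas2:
  assumes "x + y = 1"
  shows "eval2 (lucas2 n) x y = 1 + (- y) ^ n"
proof (induction n rule: lucas2.induct)
  case 1
  show ?case
    by (simp add: eval2_def)
next
  case 2
  show ?case
    using assms by (simp add: eval2_simps)
next
  case (3 n)
  have "eval2 (lucas2 (Suc (Suc n))) x y = x * (1 + (- y) ^ Suc n) + y * (1 + (- y) ^ n)"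
    using 3 by (simp only: lucas2.simps eval2_simps)
  also have "\<dots> = (1 - y) * (1 + (- y) ^ Suc n) + y * (1 + (- y) ^ n)"
    using assms by (simp flip: assms)
  also have "\<dots> = 1 + (- y) ^ Suc (Suc n)"
    by (simp add: algebra_simps)
  finally show ?case .
qed

lemma eval2_power: "eval2 (p ^ n) x y = eval2 p x y ^ n"
  by (simp add: eval2_def)

lemma sharp_num_monomials_le:
  assumes "odd d" "sharp d f"
  shows "2 * num_monomials f \<le> d + 3"
proof -
  \<comment> \<open>On \<open>x + y = 1\<close> the Lucas polynomial equals
    \<open>1 + (- y) ^ d\<close>, and for odd \<open>d\<close> adding \<open>y ^ d\<close> leaves
    exactly 1.\<close>
  define q where "q = lucas2 d + var_y ^ d"
  have "d > 0"
    using assms by (auto intro: odd_pos)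
  have coeff_q: "coeff2 q i j = coeff2 (lucas2 d) i j + (if i = 0 \<and> j = d then 1 else 0)" for i j
    using coeff2_monom[of 0 d i j] by (simp add: q_def coeff2_add)
  have nonneg: "coeff2 q i j \<ge> 0" for i j
    using coeff2_lucas2_nonneg[of d i j] by (simp add: coeff_q)
  have supp: "(i, j) \<in> insert (0, d) ((\<lambda>j. (d - 2 * j, j)) ` {..d div 2})" if "coeff2 q i j \<noteq> 0" for i j
  proof (cases "coeff2 (lucas2 d) i j = 0")
    case True
    then show ?thesis
      using that by (simp add: coeff_q split: if_splits)
  next
    case False
    then have "i + 2 * j = d"
      by (rule coeff2_lucas2_weight)
    then show ?thesis
      by (auto intro!: image_eqI[of _ _ j])
  qed
  have "i + j < Suc d" if "coeff2 q i j \<noteq> 0" for i j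
    using supp[OF that] by auto
  then have "total_degree q \<le> d"
    using total_degree_less[of "Suc d" q] by simp
  moreover have "coeff2 q d 0 \<noteq> 0"
    using coeff2_lucas2_lead[OF \<open>d > 0\<close>] by (simp add: coeff_q)
  then have "total_degree q \<ge> d"
    using monomials_degree_le[of q d 0] by simp
  moreover have "eval2 q x y = 1" if "x + y = 1" for x y
    using eval2_lucas2[OF that, of d] assms(1) by (simp add: q_def eval2_simps eval2_power)
  ultimately have "q \<in> H2 d"
    using nonneg by (auto simp: H2_def)
  then have "num_monomials f \<le> num_monomials q"
    using assms(2) by (simp add: sharp_def)
  also have "\<dots> \<le> card (insert (0, d) ((\<lambda>j. (d - 2 * j, j)) ` {..d div 2}))"
    unfolding num_monomials_def using supp by (intro card_mono) (auto simp: monomials_def)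
  also have "\<dots> \<le> Suc (card ((\<lambda>j. (d - 2 * j, j)) ` {..d div 2}))"
    by (rule card_insert_le_m1) simp_all
  also have "\<dots> \<le> Suc (Suc (d div 2))"
    using card_image_le[of "{..d div 2}" "\<lambda>j. (d - 2 * j, j)"] by simp
  finally show ?thesis
    using assms(1) by presburger
qed

section \<open>The top homogeneous part of a sharp polynomial\<close>

theorem lemma3p1:
  fixes d :: nat and f :: "real poly poly"
  assumes "odd d" and "f \<in> H2 d" and "sharp d f"
  shows "\<exists>g. f = var_x ^ d + var_y ^ d + g \<and> total_degree g < d"
proof -
  define c where "c = coeff2 f"
  define n where "n = (\<lambda>k. card (row_supp c k))"
  have "d > 0"
    using assms(1) by (auto intro: odd_pos)
  have deg: "total_degree f = d" and nonneg: "\<And>i j. c i j \<ge> 0"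
    and eval: "\<And>x y. x + y = 1 \<Longrightarrow> eval2 f x y = 1"
    using assms(2) by (auto simp: H2_def c_def)
  obtain i j where "c i j \<noteq> 0" "i + j = d"
    using total_degree_attained[of f] deg \<open>d > 0\<close> by (auto simp: c_def)
  then have "i \<in> row_supp c d"
    by (auto simp: row_supp_def)
  then have ne: "row_supp c d \<noteq> {}"
    by blast
  have q0: "quot c d = 0"
    using quot_H2_eq_0[OF assms(2)] by (simp add: c_def)
  have top: "n d \<ge> 2" "n d + (\<Sum>k=1..<d. row_cost c k) \<ge> d + 1"
    using card_row_supp_top[OF nonneg ne q0 \<open>d > 0\<close>] by (simp_all add: n_def)
  have "num_monomials f = (\<Sum>k\<le>d. n k)"
    using num_monomials_rows[OF deg] by (simp add: n_def c_def)
  also have "{..d} = insert 0 (insert d {1..<d})"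
    using \<open>d > 0\<close> by auto
  finally have "num_monomials f = n 0 + n d + (\<Sum>k=1..<d. n k)"
    using \<open>d > 0\<close> by simp
  moreover have "2 * num_monomials f \<le> d + 3"
    using sharp_num_monomials_le assms by blast
  ultimately have count: "2 * n 0 + 2 * n d + (\<Sum>k=1..<d. 2 * n k) \<le> d + 3"
    by (simp add: sum_distrib_left)
  have cost: "(\<Sum>k=1..<d. row_cost c k) \<le> (\<Sum>k=1..<d. 2 * n k)"
    by (intro sum_mono) (simp add: row_cost_le n_def)
  \<comment> \<open>Combining the three estimates gives \<open>2 * n 0 + n d \<le> 2\<close>, while
    \<open>n d \<ge> 2\<close>.\<close>
  have two: "n d = 2" and "n 0 = 0"
    using top count cost by linarith+
  \<comment> \<open>The bounds hold with equality, so one pure power of positive degree below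
    \<open>d\<close>, making the cost estimate strict, would already contradict them.\<close>
  have pure: "c 0 k = 0 \<and> c k 0 = 0" if "k < d" for k
  proof (cases "k = 0")
    case True
    then show ?thesis
      using \<open>n 0 = 0\<close> by (auto simp: n_def row_supp_def)
  next
    case False
    show ?thesis
    proof (rule ccontr)
      assume "\<not> (c 0 k = 0 \<and> c k 0 = 0)"
      then have "row_cost c k < 2 * n k"
        using row_cost_less[of c k] by (auto simp: n_def)
      then have "(\<Sum>k=1..<d. row_cost c k) < (\<Sum>k=1..<d. 2 * n k)"
        using that False by (intro sum_strict_mono_ex1) (auto simp: row_cost_le n_def)
      then show False
        using top count by linarith
    qed
  qed
  \<comment> \<open>At \<open>(0, 1)\<close> only pure powers of \<open>y\<close> and the constant
    survive, and below degree \<open>d\<close> these are absent; likewise at \<open>(1, 0)\<close>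
    for \<open>x\<close>.\<close>
  have "eval2 f 0 1 = (\<Sum>k\<le>d. \<Sum>i\<le>k. if i = 0 then c 0 k else 0)"
    unfolding eval2_rows[OF deg] by (intro sum.cong) (auto simp: c_def)
  also have "\<dots> = (\<Sum>k\<le>d. c 0 k)"
    by (simp add: sum.delta)
  also have "\<dots> = (\<Sum>k\<in>{d}. c 0 k)"
    using pure by (intro sum.mono_neutral_right) auto
  finally have c0d: "c 0 d = 1"
    using eval[of 0 1] by simp
  have "eval2 f 1 0 = (\<Sum>k\<le>d. \<Sum>i\<le>k. if i = k then c i 0 else 0)"
    unfolding eval2_rows[OF deg] by (intro sum.cong) (auto simp: c_def)
  also have "\<dots> = (\<Sum>k\<le>d. c k 0)"
    by (simp add: sum.delta)
  also have "\<dots> = (\<Sum>k\<in>{d}. c k 0)"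
    using pure by (intro sum.mono_neutral_right) auto
  finally have cd0: "c d 0 = 1"
    using eval[of 1 0] by simp
  have "{0, d} \<subseteq> row_supp c d"
    using c0d cd0 by (auto simp: row_supp_def)
  moreover have "card {0, d} = card (row_supp c d)"
    using two \<open>d > 0\<close> by (simp add: n_def)
  ultimately have supp: "row_supp c d = {0, d}"
    by (metis card_subset_eq finite_row_supp)
  define g where "g = f - var_x ^ d - var_y ^ d"
  have coeff_g: "coeff2 g i j =
      c i j - (if i = d \<and> j = 0 then 1 else 0) - (if i = 0 \<and> j = d then 1 else 0)" for i j
    using coeff2_monom[of d 0 i j] coeff2_monom[of 0 d i j] by (simp add: g_def coeff2_diff c_def)
  have "total_degree g < d"
  proof (rule total_degree_less[OF \<open>d > 0\<close>])
    fix i j assume nz: "coeff2 g i j \<noteq> 0"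
    \<comment> \<open>If \<open>c i j\<close> were 0, a nonzero coefficient of \<open>g\<close>
      could only come from a subtracted monomial, but there \<open>c\<close> equals 1.\<close>
    then have "c i j \<noteq> 0"
      using c0d cd0 by (auto simp: coeff_g split: if_splits)
    then have "i + j \<le> d"
      using monomials_degree_le[of f i j] deg by (simp add: c_def)
    moreover have "i + j \<noteq> d"
    proof
      assume "i + j = d"
      then have "i \<in> row_supp c d"
        using \<open>c i j \<noteq> 0\<close> by (auto simp: row_supp_def)
      then show False
        using nz \<open>i + j = d\<close> c0d cd0 \<open>d > 0\<close> by (auto simp: supp coeff_g)
    qed
    ultimately show "i + j < d"
      by simp
  qed
  moreover have "f = var_x ^ d + var_y ^ d + g"
    by (simp add: g_def)
  ultimately show ?thesis
    by blast
qed

end
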